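(* Consider the exponential bricklayers' model with parameter $\beta>0$. Let $n\ge1$, $\theta_{\rm left}\in\mathbb R$, and let $\xi:\mathbb Z+\frac12\to\mathbb Z_{\ge0}$ satisfy $\sum_x\xi(x)=n$ ($\xi(x)$ is the number of walkers at $x$). Put $$\theta_i(\xi)=\theta_{\rm left}-\beta\sum_{x\in\mathbb Z+\frac12,\ x<i}\xi(x),\qquad i\in\mathbb Z,$$ and for $x\in\mathbb Z+\frac12$ let $k(x)=\sum_{y<x}\xi(y)$ be the number of walkers strictly to the left of $x$. Then $$\frac{d}{dt}\underline\mu^{(\underline\theta(\xi))}=\sum_{x:\,\xi(x)>0}\Big\{e^{\theta_{\rm left}-k(x)\beta}\left(1-e^{-\xi(x)\beta}\right)\left(\underline\mu^{(\underline\theta(\xi^{x\to x+1}))}-\underline\mu^{(\underline\theta(\xi))}\right)+e^{-\theta_{\rm left}+k(x)\beta}\left(e^{\xi(x)\beta}-1\right)\left(\underline\mu^{(\underline\theta(\xi^{x\to x-1}))}-\underline\mu^{(\underline\theta(\xi))}\right)\Big\},$$ where $\xi^{x\to x\pm1}$ is obtained from $\xi$ by moving one walker from $x$ to $x\pm1$. That is, for every bounded cylinder function $\varphi$, $\mathbf E^{(\underline\theta(\xi))}[(L\varphi)(\underline\omega)]$ equals the right-hand side with each measure $\underline\mu^{(\cdot)}$ replaced by $\mathbf E^{(\cdot)}\varphi(\underline\omega)$. Thus the $n$ shocks of size one evolve as $n$ nearest-neighbor random walkers on $\mathbb Z+\frac12$ which interact only through their jump rates: from a site with $m>0$ walkers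 and $k$ walkers strictly to its left, one walker jumps to the right with rate $e^{\theta_{\rm left}-k\beta}(1-e^{-m\beta})$ and to the left with rate $e^{-\theta_{\rm left}+k\beta}(e^{m\beta}-1)$. In particular, a single shock of size one ($n=1$, $\theta_{\rm right}=\theta_{\rm left}-\beta$) jumps to the right with constant rate $e^{\theta_{\rm left}}-e^{\theta_{\rm right}}$ and to the left with constant rate $e^{-\theta_{\rm right}}-e^{-\theta_{\rm left}}$.
   Context: Exponential bricklayers' model with parameter $\beta>0$: the state space is $\Omega=\mathbb Z^{\mathbb Z}$, with elements $\underline\omega=(\omega_i)_{i\in\mathbb Z}$, and rate function $r(z)=e^{-\beta/2}e^{\beta z}$, $z\in\mathbb Z$. Let $\underline\omega^{(i,i+1)}$ be obtained from $\underline\omega$ by replacing $\omega_i$ by $\omega_i-1$ and $\omega_{i+1}$ by $\omega_{i+1}+1$. A cylinder function is a function on $\Omega$ depending on finitely many coordinates. On bounded cylinder functions the generator is $(L\varphi)(\underline\omega)=\sum_{i\in\mathbb Z}[r(\omega_i)+r(-\omega_{i+1})][\varphi(\underline\omega^{(i,i+1)})-\varphi(\underline\omega)]$. Existence of the dynamics is assumed; $\frac{d}{dt}\underline\mu^{(\underline\theta)}$ is understood through $\frac{d}{dt}\mathbf E^{(\underline\theta)}\varphi(\underline\omega)=\mathbf E^{(\underline\theta)}[(L\varphi)(\underline\omega)]$ for bounded cylinder $\varphi$. For $\theta\in\mathbb R$, $\mu^{(\theta)}$ is the probability measure on $\mathbb Z$ proportional to $e^{\theta z}/r(z)!$, where $r(z)!=\prod_{y=1}^{|z|}r(y)$;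 equivalently $\mu^{(\theta)}(z)$ is proportional to $e^{-\frac\beta2(z-\theta/\beta)^2}$. For $\underline\theta=(\theta_i)_{i\in\mathbb Z}$ taking finitely many values, $\underline\mu^{(\underline\theta)}$ is the product measure on $\Omega$ with marginal $\mu^{(\theta_i)}$ at site $i$, and $\mathbf E^{(\underline\theta)}$ is its expectation. A decrease of $\theta_i$ by $m\beta$ from $i=Q-1$ to $i=Q$ is called a shock of size $m$ located at $Q-\frac12$, and is represented by $m$ walkers at $Q-\frac12$. *)

theory Defs
  imports "HOL-Probability.Probability"
begin

type_synonym config = "int \<Rightarrow> int"

definition rate :: "real \<Rightarrow> int \<Rightarrow> real" where
  "rate \<beta> z = exp (- \<beta> / 2) * exp (\<beta> * of_int z)"

definition rate_fact :: "real \<Rightarrow> int \<Rightarrow> real" where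
  "rate_fact \<beta> z = (\<Prod>y\<in>{1..\<bar>z\<bar>}. rate \<beta> y)"

definition lay_brick :: "config \<Rightarrow> int \<Rightarrow> config" where
  "lay_brick \<eta> i = \<eta>(i := \<eta> i - 1, i + 1 := \<eta> (i + 1) + 1)"

definition cylinder :: "(config \<Rightarrow> real) \<Rightarrow> bool" where
  "cylinder \<phi> \<longleftrightarrow>
     (\<exists>I. finite I \<and> (\<forall>\<omega> \<omega>'. (\<forall>i\<in>I. \<omega> i = \<omega>' i) \<longrightarrow> \<phi> \<omega> = \<phi> \<omega>'))"

(* For a cylinder function only finitely many summands are nonzero. *)
definition generator :: "real \<Rightarrow> (config \<Rightarrow> real) \<Rightarrow> config \<Rightarrow> real" where
  "generator \<beta> \<phi> \<eta> =
     (\<Sum>\<^sub>\<infinity>i\<in>UNIV. (rate \<beta> (\<eta> i) + rate \<beta> (- \<eta> (i + 1))) * (\<phi> (lay_brick \<eta> i) - \<phi> \<eta>))"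

definition weight :: "real \<Rightarrow> real \<Rightarrow> int \<Rightarrow> real" where
  "weight \<beta> \<theta> z = exp (\<theta> * of_int z) / rate_fact \<beta> z"

(* embed_pmf is unspecified unless its argument sums to 1; pmf_site_measure below
   shows that it does. *)
definition site_measure :: "real \<Rightarrow> real \<Rightarrow> int pmf" where
  "site_measure \<beta> \<theta> = embed_pmf (\<lambda>z. weight \<beta> \<theta> z / (\<Sum>\<^sub>\<infinity>y\<in>UNIV. weight \<beta> \<theta> y))"

lemma rate_fact_eq: "rate_fact \<beta> z = exp (\<beta> * (of_int z)\<^sup>2 / 2)"
proof -
  have *: "(\<Prod>y\<in>{1..int n}. rate \<beta> y) = exp (\<beta> * (real n)\<^sup>2 / 2)" for n
  proof (induction n)
    case (Suc n)
    have "{1..int (Suc n)} = insert (int (Suc n)) {1..int n}" by auto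
    then show ?case using Suc
      by (simp add: rate_def flip: exp_add) (simp add: field_simps power2_eq_square)
  qed simp
  show ?thesis
    using *[of "nat \<bar>z\<bar>"] by (simp add: rate_fact_def)
qed

lemma weight_pos: "weight \<beta> \<theta> z > 0"
  by (simp add: weight_def rate_fact_eq)

lemma weight_summable:
  assumes "\<beta> > 0" shows "weight \<beta> \<theta> summable_on UNIV"
proof -
  have *: "summable (\<lambda>n. exp (c * real n) / exp (\<beta> * (real n)\<^sup>2 / 2))" for c
  proof (rule summable_comparison_test_ev)
    show "summable (\<lambda>n::nat. exp (-1::real) ^ n)"
      by (rule summable_geometric) simp
    have "eventually (\<lambda>n::nat. real n \<ge> 2 * (c + 1) / \<beta>) sequentially"
      by (meson eventually_sequentially nat_ceiling_le_eq)
    then show "eventually (\<lambda>n. norm (exp (c * real n) / exp (\<beta> * (real n)\<^sup>2 / 2)) \<le> exp (-1::real) ^ n) sequentially"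
    proof eventually_elim
      case (elim n)
      then have "(c + 1) * real n \<le> (\<beta> * real n / 2) * real n"
        using assms by (intro mult_right_mono) (auto simp: field_simps)
      then show ?case
        by (simp add: exp_of_nat_mult[symmetric] exp_diff[symmetric] power2_eq_square algebra_simps)
    qed
  qed
  have 1: "weight \<beta> \<theta> summable_on range int"
    using *[of \<theta>] by (subst summable_on_reindex)
      (auto simp: o_def weight_def rate_fact_eq intro!: norm_summable_imp_summable_on)
  have 2: "weight \<beta> \<theta> summable_on range (\<lambda>n. - int n)"
    using *[of "-\<theta>"] by (subst summable_on_reindex)
      (auto simp: o_def weight_def rate_fact_eq inj_on_def intro!: norm_summable_imp_summable_on)
  have "UNIV = range int \<union> (range (\<lambda>n. - int n))"
    using int_cases2 by (auto simp: image_iff) (metis int_cases2)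
  then show ?thesis
    using summable_on_union[OF 1 2] by simp
qed

lemma pmf_site_measure:
  assumes "\<beta> > 0"
  shows "pmf (site_measure \<beta> \<theta>) z = weight \<beta> \<theta> z / (\<Sum>\<^sub>\<infinity>y\<in>UNIV. weight \<beta> \<theta> y)"
proof -
  let ?w = "weight \<beta> \<theta>" and ?Z = "\<Sum>\<^sub>\<infinity>y\<in>UNIV. weight \<beta> \<theta> y"
  note S = weight_summable[OF assms, of \<theta>]
  have "?w 0 \<le> ?Z"
    using finite_sum_le_infsum[OF S, of "{0}"] by (simp add: less_imp_le weight_pos)
  then have Z: "?Z > 0" using weight_pos[of \<beta> \<theta> 0] by linarith
  have abs: "Infinite_Set_Sum.abs_summable_on ?w UNIV"
    using S abs_summable_equivalent summable_on_iff_abs_summable_on_real by blast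
  have "(\<integral>\<^sup>+ x. ennreal (?w x / ?Z) \<partial>count_space UNIV) = ennreal (infsetsum (\<lambda>x. ?w x / ?Z) UNIV)"
    using abs Z by (intro nn_integral_conv_infsetsum) (auto simp: less_imp_le weight_pos divide_inverse intro!: abs_summable_on_cmult_left)
  also have "infsetsum (\<lambda>x. ?w x / ?Z) UNIV = infsetsum ?w UNIV / ?Z"
    by (simp add: divide_inverse infsetsum_cmult_left abs)
  also have "infsetsum ?w UNIV = ?Z" using abs by (rule infsetsum_infsum)
  finally show ?thesis
    unfolding site_measure_def using Z
    by (intro pmf_embed_pmf) (auto simp: less_imp_le weight_pos)
qed

definition product_measure :: "real \<Rightarrow> (int \<Rightarrow> real) \<Rightarrow> config measure" where
  "product_measure \<beta> \<theta> = PiM UNIV (\<lambda>i. measure_pmf (site_measure \<beta> (\<theta> i)))"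

definition expect :: "real \<Rightarrow> (int \<Rightarrow> real) \<Rightarrow> (config \<Rightarrow> real) \<Rightarrow> real" where
  "expect \<beta> \<theta> \<phi> = (\<integral>\<omega>. \<phi> \<omega> \<partial>product_measure \<beta> \<theta>)"

(* Walker configurations are functions on reals of which only the restriction
   to the lattice half_ints is ever used. *)
definition half_ints :: "real set" where
  "half_ints = range (\<lambda>j::int. of_int j + 1 / 2)"

definition walkers_left :: "(real \<Rightarrow> nat) \<Rightarrow> real \<Rightarrow> nat" where
  "walkers_left \<xi> a = (\<Sum>\<^sub>\<infinity>y\<in>{y \<in> half_ints. y < a}. \<xi> y)"

definition profile :: "real \<Rightarrow> real \<Rightarrow> (real \<Rightarrow> nat) \<Rightarrow> int \<Rightarrow> real" where
  "profile \<beta> \<theta>left \<xi> i = \<theta>left - \<beta> * real (walkers_left \<xi> (of_int i))"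

definition move_walker :: "(real \<Rightarrow> nat) \<Rightarrow> real \<Rightarrow> real \<Rightarrow> real \<Rightarrow> nat" where
  "move_walker \<xi> x y = \<xi>(x := \<xi> x - 1, y := \<xi> y + 1)"

(* Size m shock at Q - 1/2; size 0 means that the profile is flat there. *)
definition shock :: "real \<Rightarrow> (int \<Rightarrow> real) \<Rightarrow> int \<Rightarrow> nat \<Rightarrow> bool" where
  "shock \<beta> \<theta> Q m \<longleftrightarrow> \<theta> Q = \<theta> (Q - 1) - real m * \<beta>"

(* Jump rates from a site with m walkers and k walkers strictly to its left. *)
definition right_rate :: "real \<Rightarrow> real \<Rightarrow> nat \<Rightarrow> nat \<Rightarrow> real" where
  "right_rate \<beta> \<theta>left m k = exp (\<theta>left - real k * \<beta>) * (1 - exp (- real m * \<beta>))"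

definition left_rate :: "real \<Rightarrow> real \<Rightarrow> nat \<Rightarrow> nat \<Rightarrow> real" where
  "left_rate \<beta> \<theta>left m k = exp (- \<theta>left + real k * \<beta>) * (exp (real m * \<beta>) - 1)"

definition walkers_generator ::
    "real \<Rightarrow> real \<Rightarrow> ((real \<Rightarrow> nat) \<Rightarrow> real) \<Rightarrow> (real \<Rightarrow> nat) \<Rightarrow> real" where
  "walkers_generator \<beta> \<theta>left f \<xi> =
     (\<Sum>x\<in>{x \<in> half_ints. \<xi> x > 0}.
        right_rate \<beta> \<theta>left (\<xi> x) (walkers_left \<xi> x) * (f (move_walker \<xi> x (x + 1)) - f \<xi>)
      + left_rate \<beta> \<theta>left (\<xi> x) (walkers_left \<xi> x) * (f (move_walker \<xi> x (x - 1)) - f \<xi>))"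

definition step_profile :: "real \<Rightarrow> real \<Rightarrow> real \<Rightarrow> int \<Rightarrow> real" where
  "step_profile \<theta>left \<theta>right x i = (if of_int i < x then \<theta>left else \<theta>right)"

end

(* The one-site weight is Gaussian, so raising theta by k * beta translates the measure by k,
   and tilting by the exponential rate r(s z) with s = 1 or s = -1 multiplies it by the constant
   exp(s theta) and translates it by s.  Under the product measure, each summand of the generator
   therefore becomes a combination of expectations under profiles changed at a single site.
   Summation by parts collects the coefficient exp(theta (i-1)) - exp(theta i) in front of raising
   theta at i, and exp(-theta (i+1)) - exp(-theta i) in front of lowering it.  These vanish unless
   there is a shock next to i, in which case changing theta at i moves one walker across i. *)
theory Submission
  imports Defs
begin

section \<open>The one-site measures\<close>

text \<open>Completing the square: the exponent
  \<open>\<theta> z + k \<beta> z - \<beta> z^2 / 2\<close> equals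
  \<open>\<theta> (z - k) - \<beta> (z - k)^2 / 2\<close> plus the constant
  \<open>\<theta> k + \<beta> k^2 / 2\<close>.\<close>

lemma weight_shift:
  "weight \<beta> (\<theta> + of_int k * \<beta>) z = exp (\<theta> * of_int k + \<beta> * (of_int k)\<^sup>2 / 2) * weight \<beta> \<theta> (z - k)"
  by (simp add: weight_def rate_fact_eq field_simps power2_eq_square flip: exp_add exp_diff)

text \<open>The constant from \<open>weight_shift\<close> also appears in the normalising sum, which
  is invariant under translation, so it cancels.\<close>

lemma pmf_site_measure_shift:
  assumes "\<beta> > 0"
  shows "pmf (site_measure \<beta> (\<theta> + of_int k * \<beta>)) z = pmf (site_measure \<beta> \<theta>) (z - k)"
proof -
  have bij: "bij_betw (\<lambda>z. z - k) UNIV UNIV"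
    by (rule bij_betw_byWitness[where f' = "\<lambda>z. z + k"]) auto
  have "(\<Sum>\<^sub>\<infinity>y. weight \<beta> \<theta> (y - k)) = (\<Sum>\<^sub>\<infinity>y. weight \<beta> \<theta> y)"
    by (rule infsum_reindex_bij_betw[OF bij])
  then have "(\<Sum>\<^sub>\<infinity>y. weight \<beta> (\<theta> + of_int k * \<beta>) y)
      = exp (\<theta> * of_int k + \<beta> * (of_int k)\<^sup>2 / 2) * (\<Sum>\<^sub>\<infinity>y. weight \<beta> \<theta> y)"
    by (simp add: weight_shift infsum_cmult_right')
  then show ?thesis
    using assms by (simp add: pmf_site_measure weight_shift)
qed

lemma site_measure_shift:
  assumes "\<beta> > 0"
  shows "site_measure \<beta> (\<theta> + of_int k * \<beta>) = map_pmf (\<lambda>z. z + k) (site_measure \<beta> \<theta>)"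
proof (rule pmf_eqI)
  fix z
  have "inj (\<lambda>z::int. z + k)" by (simp add: inj_def)
  then have "pmf (map_pmf (\<lambda>z. z + k) (site_measure \<beta> \<theta>)) ((z - k) + k) = pmf (site_measure \<beta> \<theta>) (z - k)"
    by (rule pmf_map_inj')
  then show "pmf (site_measure \<beta> (\<theta> + of_int k * \<beta>)) z = pmf (map_pmf (\<lambda>z. z + k) (site_measure \<beta> \<theta>)) z"
    by (simp add: pmf_site_measure_shift[OF assms])
qed

text \<open>Since \<open>s^2 = 1\<close>, the factor \<open>exp (- \<beta> / 2)\<close> in the rate
  is exactly what completes the square \<open>- \<beta> (z - s)^2 / 2\<close>; only
  \<open>exp (s \<theta>)\<close> is left over. The sign \<open>s = 1\<close> serves the rate at the
  left site of a brick, \<open>s = - 1\<close> the rate at the right site.\<close>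

lemma rate_times_pmf:
  assumes "\<beta> > 0" and s: "\<bar>s\<bar> = 1"
  shows "rate \<beta> (s * z) * pmf (site_measure \<beta> \<theta>) z
    = exp (of_int s * \<theta>) * pmf (site_measure \<beta> (\<theta> + of_int s * \<beta>)) z"
proof -
  have "s = 1 \<or> s = - 1" using s by linarith
  then have "rate \<beta> (s * z) * weight \<beta> \<theta> z = exp (of_int s * \<theta>) * weight \<beta> \<theta> (z - s)"
    by (auto simp: weight_def rate_fact_eq rate_def field_simps power2_eq_square simp flip: exp_add exp_diff)
  then show ?thesis
    using assms(1) by (subst pmf_site_measure_shift) (simp_all add: pmf_site_measure)
qed

text \<open>Stated for nonnegative integrals, so that no integrability of the unbounded rate has to
  be known beforehand.\<close>

lemma nn_integral_site_measure_rate: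
  assumes "\<beta> > 0" and "\<bar>s\<bar> = 1"
  shows "(\<integral>\<^sup>+z. ennreal (rate \<beta> (s * z)) * h z \<partial>site_measure \<beta> \<theta>)
    = ennreal (exp (of_int s * \<theta>)) * (\<integral>\<^sup>+z. h z \<partial>site_measure \<beta> (\<theta> + of_int s * \<beta>))"
proof -
  have r: "rate \<beta> y \<ge> 0" for y by (simp add: rate_def)
  have "ennreal (pmf (site_measure \<beta> \<theta>) z) * (ennreal (rate \<beta> (s * z)) * h z)
      = ennreal (exp (of_int s * \<theta>)) * (ennreal (pmf (site_measure \<beta> (\<theta> + of_int s * \<beta>)) z) * h z)" for z
    using arg_cong[OF rate_times_pmf[OF assms, of z \<theta>], of ennreal]
    by (simp add: ennreal_mult r mult_ac)
  then show ?thesis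
    by (simp add: nn_integral_measure_pmf nn_integral_cmult)
qed

section \<open>Changing one coordinate of the product measure\<close>

text \<open>The sigma-algebra is the same for all parameters, which lets measurability pass between
  product measures with different profiles.\<close>

lemma sets_product_measure: "sets (product_measure \<beta> \<theta>) = sets (PiM UNIV (\<lambda>_. count_space UNIV))"
  unfolding product_measure_def by (rule sets_PiM_cong) auto

lemma space_product_measure [simp]: "space (product_measure \<beta> \<theta>) = UNIV"
  by (simp add: product_measure_def space_PiM)

lemma measurable_product_measure_cong:
  "measurable (product_measure \<beta> \<theta>) = measurable (PiM UNIV (\<lambda>_. count_space UNIV))"
  by (intro ext measurable_cong_sets sets_product_measure) auto

lemma prob_space_product_measure: "prob_space (product_measure \<beta> \<theta>)"
  unfolding product_measure_def by (intro prob_space_PiM measure_pmf.prob_space_axioms)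

text \<open>Tonelli after splitting off site \<open>i\<close>: the full product is the image of the
  marginal at \<open>i\<close> times the product over the other sites, under the map that inserts
  the value at \<open>i\<close>.\<close>

lemma nn_integral_product_measure:
  assumes f: "f \<in> borel_measurable (product_measure \<beta> \<theta>)"
  shows "(\<integral>\<^sup>+\<omega>. f \<omega> \<partial>product_measure \<beta> \<theta>)
    = (\<integral>\<^sup>+\<omega>. (\<integral>\<^sup>+z. f (fun_upd \<omega> i z) \<partial>site_measure \<beta> (\<theta> i))
        \<partial>PiM (- {i}) (\<lambda>j. measure_pmf (site_measure \<beta> (\<theta> j))))"
proof -
  let ?M = "\<lambda>j. measure_pmf (site_measure \<beta> (\<theta> j))"
  interpret N: prob_space "PiM (- {i}) ?M"
    by (intro prob_space_PiM measure_pmf.prob_space_axioms)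
  interpret pair_sigma_finite "?M i" "PiM (- {i}) ?M"
    by unfold_locales
  have ins: "insert i (- {i}) = UNIV" by auto
  have P: "distr (?M i \<Otimes>\<^sub>M PiM (- {i}) ?M) (product_measure \<beta> \<theta>) (\<lambda>(z, \<omega>). fun_upd \<omega> i z) = product_measure \<beta> \<theta>"
    using distr_pair_PiM_eq_PiM[of "- {i}" ?M i] measure_pmf.prob_space_axioms
    unfolding ins product_measure_def by auto
  have upd [measurable]: "(\<lambda>(z, \<omega>). fun_upd \<omega> i z) \<in> measurable (?M i \<Otimes>\<^sub>M PiM (- {i}) ?M) (product_measure \<beta> \<theta>)"
    unfolding product_measure_def case_prod_unfold by (rule measurable_fun_upd[where J = "- {i}"]) auto
  note f [measurable]
  have "(\<integral>\<^sup>+\<omega>. f \<omega> \<partial>product_measure \<beta> \<theta>)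
      = (\<integral>\<^sup>+p. f ((\<lambda>(z, \<omega>). fun_upd \<omega> i z) p) \<partial>(?M i \<Otimes>\<^sub>M PiM (- {i}) ?M))"
    by (subst P[symmetric], subst nn_integral_distr) simp_all
  also have "\<dots> = (\<integral>\<^sup>+\<omega>. (\<integral>\<^sup>+z. f (fun_upd \<omega> i z) \<partial>?M i) \<partial>PiM (- {i}) ?M)"
    by (subst nn_integral_snd[symmetric]) (auto simp: case_prod_unfold)
  finally show ?thesis .
qed

text \<open>The conditional is the form in which an update of the profile at \<open>i\<close>
  appears after simplification; off \<open>i\<close> it has no effect.\<close>

lemma PiM_remove_coordinate:
  "PiM (- {i}) (\<lambda>j. measure_pmf (site_measure \<beta> (if j = i then c else \<theta> j)))
    = PiM (- {i}) (\<lambda>j. measure_pmf (site_measure \<beta> (\<theta> j)))"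
  by (rule PiM_cong) auto

lemma measurable_upd_count_space:
  "(\<lambda>\<omega>::int \<Rightarrow> int. fun_upd \<omega> i (g (\<omega> i)))
    \<in> measurable (PiM UNIV (\<lambda>_. count_space UNIV)) (PiM UNIV (\<lambda>_. count_space UNIV))"
  by (rule measurable_PiM_single') (auto simp: fun_upd_def intro!: measurable_compose[OF measurable_component_singleton])

text \<open>Integrating out site \<open>i\<close> first reduces both sides to
  \<open>site_measure_shift\<close> at that site, the other marginals being equal.\<close>

lemma distr_product_measure_shift:
  assumes "\<beta> > 0"
  shows "distr (product_measure \<beta> \<theta>) (product_measure \<beta> \<theta>) (\<lambda>\<omega>. fun_upd \<omega> i (\<omega> i + k))
    = product_measure \<beta> (\<theta>(i := \<theta> i + of_int k * \<beta>))" (is "distr ?P ?P ?g = ?P'")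
proof (rule measure_eqI)
  show "sets (distr ?P ?P ?g) = sets ?P'" by (simp add: sets_product_measure)
  fix A assume "A \<in> sets (distr ?P ?P ?g)"
  then have A: "A \<in> sets (PiM UNIV (\<lambda>_. count_space UNIV))" by (simp add: sets_product_measure)
  have ind: "indicator A \<in> (borel_measurable (product_measure \<beta> \<theta>') :: (_ \<Rightarrow> ennreal) set)" for \<theta>' :: "int \<Rightarrow> real"
    using A by (intro borel_measurable_indicator) (simp add: sets_product_measure)
  have g: "?g \<in> measurable (PiM UNIV (\<lambda>_. count_space UNIV)) (PiM UNIV (\<lambda>_. count_space UNIV))"
    by (rule measurable_upd_count_space)
  have gP: "?g \<in> measurable ?P ?P"
    using g by (simp add: measurable_product_measure_cong measurable_cong_sets[OF refl sets_product_measure])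
  have "emeasure (distr ?P ?P ?g) A = (\<integral>\<^sup>+\<omega>. indicator A \<omega> \<partial>distr ?P ?P ?g)"
    using A by (simp add: sets_product_measure)
  also have "\<dots> = (\<integral>\<^sup>+\<omega>. indicator A (?g \<omega>) \<partial>?P)"
    using gP ind by (intro nn_integral_distr) auto
  also have "\<dots> = (\<integral>\<^sup>+\<omega>. (\<integral>\<^sup>+z. indicator A (fun_upd \<omega> i (z + k)) \<partial>site_measure \<beta> (\<theta> i))
        \<partial>PiM (- {i}) (\<lambda>j. measure_pmf (site_measure \<beta> (\<theta> j))))"
  proof (subst nn_integral_product_measure[where i = i])
    show "(\<lambda>\<omega>. indicator A (?g \<omega>) :: ennreal) \<in> borel_measurable ?P"
      using measurable_compose[OF gP ind] by simp
  qed simp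
  also have "\<dots> = (\<integral>\<^sup>+\<omega>. indicator A \<omega> \<partial>?P')"
    using ind by (subst nn_integral_product_measure[where i = i])
      (auto simp: sets_product_measure PiM_remove_coordinate site_measure_shift[OF assms])
  finally show "emeasure (distr ?P ?P ?g) A = emeasure ?P' A"
    using A by (simp add: sets_product_measure)
qed

text \<open>The factor \<open>exp (- s \<theta> i)\<close> is the one that turns the rate into a
  probability density; integrating out site \<open>i\<close> reduces the claim to the one-site
  tilt.\<close>

lemma density_product_measure_rate:
  assumes "\<beta> > 0" and "\<bar>s\<bar> = 1"
  shows "density (product_measure \<beta> \<theta>) (\<lambda>\<omega>. ennreal (exp (- of_int s * \<theta> i) * rate \<beta> (s * \<omega> i)))
    = product_measure \<beta> (\<theta>(i := \<theta> i + of_int s * \<beta>))" (is "density ?P ?g = ?P'")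
proof (rule measure_eqI)
  show "sets (density ?P ?g) = sets ?P'" by (simp add: sets_product_measure)
  fix A assume "A \<in> sets (density ?P ?g)"
  then have A: "A \<in> sets (PiM UNIV (\<lambda>_. count_space UNIV))" by (simp add: sets_product_measure)
  have ind: "indicator A \<in> (borel_measurable (product_measure \<beta> \<theta>') :: (_ \<Rightarrow> ennreal) set)" for \<theta>' :: "int \<Rightarrow> real"
    using A by (intro borel_measurable_indicator) (simp add: sets_product_measure)
  have g: "?g \<in> borel_measurable ?P"
    unfolding measurable_product_measure_cong
    by (rule measurable_compose[OF measurable_component_singleton]) auto
  have r: "rate \<beta> y \<ge> 0" for y by (simp add: rate_def)
  have "emeasure (density ?P ?g) A = (\<integral>\<^sup>+\<omega>. ?g \<omega> * indicator A \<omega> \<partial>?P)"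
    using A g by (intro emeasure_density) (auto simp: sets_product_measure)
  also have "\<dots> = (\<integral>\<^sup>+\<omega>. (\<integral>\<^sup>+z. ennreal (exp (- of_int s * \<theta> i) * rate \<beta> (s * z)) * indicator A (fun_upd \<omega> i z) \<partial>site_measure \<beta> (\<theta> i))
        \<partial>PiM (- {i}) (\<lambda>j. measure_pmf (site_measure \<beta> (\<theta> j))))"
    using g ind by (subst nn_integral_product_measure[where i = i]) auto
  also have "\<dots> = (\<integral>\<^sup>+\<omega>. (\<integral>\<^sup>+z. indicator A (fun_upd \<omega> i z) \<partial>site_measure \<beta> (\<theta> i + of_int s * \<beta>))
        \<partial>PiM (- {i}) (\<lambda>j. measure_pmf (site_measure \<beta> (\<theta> j))))"
  proof (rule nn_integral_cong)
    fix \<omega>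
    have "(\<integral>\<^sup>+z. ennreal (exp (- of_int s * \<theta> i) * rate \<beta> (s * z)) * indicator A (fun_upd \<omega> i z) \<partial>site_measure \<beta> (\<theta> i))
      = ennreal (exp (- of_int s * \<theta> i)) * (\<integral>\<^sup>+z. ennreal (rate \<beta> (s * z)) * indicator A (fun_upd \<omega> i z) \<partial>site_measure \<beta> (\<theta> i))"
      by (subst nn_integral_cmult[symmetric]) (auto simp: ennreal_mult r mult_ac)
    also have "\<dots> = (ennreal (exp (- of_int s * \<theta> i)) * ennreal (exp (of_int s * \<theta> i)))
        * (\<integral>\<^sup>+z. indicator A (fun_upd \<omega> i z) \<partial>site_measure \<beta> (\<theta> i + of_int s * \<beta>))"
      by (simp add: nn_integral_site_measure_rate[OF assms] mult.assoc)
    also have "ennreal (exp (- of_int s * \<theta> i)) * ennreal (exp (of_int s * \<theta> i)) = 1"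
      by (simp flip: ennreal_mult exp_add)
    finally show "(\<integral>\<^sup>+z. ennreal (exp (- of_int s * \<theta> i) * rate \<beta> (s * z)) * indicator A (fun_upd \<omega> i z) \<partial>site_measure \<beta> (\<theta> i))
      = (\<integral>\<^sup>+z. indicator A (fun_upd \<omega> i z) \<partial>site_measure \<beta> (\<theta> i + of_int s * \<beta>))"
      by (simp only: mult_1_left)
  qed
  also have "\<dots> = (\<integral>\<^sup>+\<omega>. indicator A \<omega> \<partial>?P')"
    using ind by (subst nn_integral_product_measure[where i = i])
      (auto simp: sets_product_measure PiM_remove_coordinate)
  finally show "emeasure (density ?P ?g) A = emeasure ?P' A"
    using A by (simp add: sets_product_measure)
qed

section \<open>The generator under a product measure\<close>

text \<open>Exposes the set of coordinates that is existentially hidden in \<open>cylinder\<close>;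
  this set later indexes the finite sums that replace the generator.\<close>

definition determined_by :: "int set \<Rightarrow> (config \<Rightarrow> real) \<Rightarrow> bool" where
  "determined_by I \<phi> \<longleftrightarrow> (\<forall>\<omega> \<omega>'. (\<forall>i\<in>I. \<omega> i = \<omega>' i) \<longrightarrow> \<phi> \<omega> = \<phi> \<omega>')"

lemma cylinder_iff: "cylinder \<phi> \<longleftrightarrow> (\<exists>I. finite I \<and> determined_by I \<phi>)"
  by (simp add: cylinder_def determined_by_def)

lemma determined_byD: "determined_by I \<phi> \<Longrightarrow> (\<And>i. i \<in> I \<Longrightarrow> \<omega> i = \<omega>' i) \<Longrightarrow> \<phi> \<omega> = \<phi> \<omega>'"
  by (simp add: determined_by_def)

section \<open>Cylinder functions: closure properties, measurability and integrability\<close>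

lemma cylinder_upd:
  assumes "cylinder \<phi>" shows "cylinder (\<lambda>\<omega>. \<phi> (fun_upd \<omega> i (\<omega> i + k)))"
proof -
  obtain I where I: "finite I" "determined_by I \<phi>" using assms by (auto simp: cylinder_iff)
  have "determined_by I (\<lambda>\<omega>. \<phi> (fun_upd \<omega> i (\<omega> i + k)))"
    unfolding determined_by_def by (intro allI impI determined_byD[OF I(2)]) auto
  then show ?thesis using I(1) by (auto simp: cylinder_iff)
qed

text \<open>Written as two successive one-site shifts, the form to which the shift lemma applies.\<close>
lemma lay_brick_eq: "lay_brick \<omega> i = fun_upd (fun_upd \<omega> i (\<omega> i + - 1)) (i + 1) ((fun_upd \<omega> i (\<omega> i + - 1)) (i + 1) + 1)"
  by (simp add: lay_brick_def)

lemma cylinder_lay_brick: "cylinder \<phi> \<Longrightarrow> cylinder (\<lambda>\<omega>. \<phi> (lay_brick \<omega> i))"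
  unfolding lay_brick_eq
  by (rule cylinder_upd[where \<phi> = "\<lambda>\<omega>. \<phi> (fun_upd \<omega> (i + 1) (\<omega> (i + 1) + 1))"]) (rule cylinder_upd)

lemma cylinder_diff:
  assumes "cylinder \<phi>" "cylinder \<psi>" shows "cylinder (\<lambda>\<omega>. \<phi> \<omega> - \<psi> \<omega>)"
proof -
  obtain I J where I: "finite I" "determined_by I \<phi>" and J: "finite J" "determined_by J \<psi>"
    using assms by (auto simp: cylinder_iff)
  have "determined_by (I \<union> J) (\<lambda>\<omega>. \<phi> \<omega> - \<psi> \<omega>)"
    unfolding determined_by_def
    by (intro allI impI arg_cong2[where f = minus] determined_byD[OF I(2)] determined_byD[OF J(2)]) auto
  then show ?thesis using I(1) J(1) unfolding cylinder_iff by blast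
qed

text \<open>A cylinder function factors through a restriction to finitely many coordinates, and a
  finite product of countable discrete spaces is discrete, so every function on it is
  measurable.\<close>

lemma borel_measurable_cylinder:
  assumes "cylinder \<phi>" shows "\<phi> \<in> borel_measurable (product_measure \<beta> \<theta>)"
proof -
  obtain I where I: "finite I" "determined_by I \<phi>" using assms by (auto simp: cylinder_iff)
  have "(\<lambda>\<omega>. restrict \<omega> I) \<in> measurable (PiM UNIV (\<lambda>_. count_space UNIV)) (PiM I (\<lambda>_. count_space UNIV))"
    by (rule measurable_restrict_subset) simp
  also have "PiM I (\<lambda>_. count_space (UNIV :: int set)) = count_space (PiE I (\<lambda>_. UNIV))"
    using I(1) by (intro count_space_PiM_finite) auto
  finally have "(\<lambda>\<omega>. \<phi> (restrict \<omega> I)) \<in> borel_measurable (PiM UNIV (\<lambda>_. count_space UNIV))"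
    by (rule measurable_compose) simp
  \<comment> \<open>\<open>restrict\<close> puts \<open>undefined\<close> at the sites outside
    \<open>I\<close>, and \<open>\<phi>\<close> does not see them.\<close>
  moreover have "\<phi> (restrict \<omega> I) = \<phi> \<omega>" for \<omega>
    by (rule determined_byD[OF I(2)]) simp
  ultimately show ?thesis by (simp add: measurable_product_measure_cong)
qed

lemma integrable_bounded_cylinder:
  assumes "cylinder \<phi>" "bounded (range \<phi>)"
  shows "integrable (product_measure \<beta> \<theta>) \<phi>"
proof -
  interpret prob_space "product_measure \<beta> \<theta>" by (rule prob_space_product_measure)
  obtain B where "\<And>\<omega>. norm (\<phi> \<omega>) \<le> B" using assms(2) by (auto simp: bounded_iff)
  then show ?thesis
    using borel_measurable_cylinder[OF assms(1)] by (intro integrable_const_bound[where B = B]) auto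
qed

section \<open>Expectations under shifts, brick moves and tilts by the rates\<close>

lemma expect_shift:
  assumes "\<beta> > 0" "cylinder \<phi>"
  shows "expect \<beta> \<theta> (\<lambda>\<omega>. \<phi> (fun_upd \<omega> i (\<omega> i + k))) = expect \<beta> (\<theta>(i := \<theta> i + of_int k * \<beta>)) \<phi>"
proof -
  have "(\<lambda>\<omega>. fun_upd \<omega> i (\<omega> i + k)) \<in> measurable (product_measure \<beta> \<theta>) (product_measure \<beta> \<theta>)"
    using measurable_upd_count_space[of i "\<lambda>z. z + k"]
    by (simp add: measurable_product_measure_cong measurable_cong_sets[OF refl sets_product_measure])
  then show ?thesis
    unfolding expect_def distr_product_measure_shift[OF assms(1), symmetric]
    by (rule integral_distr[symmetric]) (rule borel_measurable_cylinder[OF assms(2)])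
qed

text \<open>A brick translates site \<open>i\<close> by \<open>- 1\<close> and site
  \<open>i + 1\<close> by \<open>1\<close>; each translation is a change of the profile by
  \<open>\<beta>\<close> at that site.\<close>

lemma expect_lay_brick:
  assumes "\<beta> > 0" "cylinder \<phi>"
  shows "expect \<beta> \<theta> (\<lambda>\<omega>. \<phi> (lay_brick \<omega> i))
    = expect \<beta> (\<theta>(i := \<theta> i - \<beta>, i + 1 := \<theta> (i + 1) + \<beta>)) \<phi>"
  unfolding lay_brick_eq
  by (subst expect_shift[OF assms(1), where \<phi> = "\<lambda>\<omega>. \<phi> (fun_upd \<omega> (i + 1) (\<omega> (i + 1) + 1))"])
    (auto simp: cylinder_upd expect_shift assms)

text \<open>Up to a constant the rate is the density of another product measure, under which the
  bounded \<open>\<phi>\<close> is integrable. This gives integrability of the product although the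
  rate itself is unbounded.\<close>

lemma expect_rate:
  assumes "\<beta> > 0" "cylinder \<phi>" "bounded (range \<phi>)" "\<bar>s\<bar> = 1"
  shows "integrable (product_measure \<beta> \<theta>) (\<lambda>\<omega>. rate \<beta> (s * \<omega> i) * \<phi> \<omega>)"
    and "expect \<beta> \<theta> (\<lambda>\<omega>. rate \<beta> (s * \<omega> i) * \<phi> \<omega>)
      = exp (of_int s * \<theta> i) * expect \<beta> (\<theta>(i := \<theta> i + of_int s * \<beta>)) \<phi>"
proof -
  let ?P = "product_measure \<beta> \<theta>" and ?P' = "product_measure \<beta> (\<theta>(i := \<theta> i + of_int s * \<beta>))"
  let ?g = "\<lambda>\<omega>. exp (- of_int s * \<theta> i) * rate \<beta> (s * \<omega> i)"
  have g: "?g \<in> borel_measurable ?P"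
    unfolding measurable_product_measure_cong
    by (rule measurable_compose[OF measurable_component_singleton]) auto
  have g0: "AE \<omega> in ?P. 0 \<le> ?g \<omega>" by (simp add: rate_def)
  note \<phi> = borel_measurable_cylinder[OF assms(2), of \<beta> \<theta>]
  have eq: "rate \<beta> (s * \<omega> i) * \<phi> \<omega> = exp (of_int s * \<theta> i) * (?g \<omega> * \<phi> \<omega>)" for \<omega>
    by (simp add: mult.assoc[symmetric] flip: exp_add)
  have "integrable ?P' \<phi>" by (rule integrable_bounded_cylinder) fact+
  then have int: "integrable ?P (\<lambda>\<omega>. ?g \<omega> * \<phi> \<omega>)"
    unfolding density_product_measure_rate[OF assms(1,4), symmetric] integrable_real_density[OF g g0 \<phi>] .
  show "integrable ?P (\<lambda>\<omega>. rate \<beta> (s * \<omega> i) * \<phi> \<omega>)"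
    unfolding eq using int by (intro integrable_mult_right) auto
  have "integral\<^sup>L ?P' \<phi> = (\<integral>\<omega>. ?g \<omega> * \<phi> \<omega> \<partial>?P)"
    unfolding density_product_measure_rate[OF assms(1,4), symmetric] integral_real_density[OF g g0 \<phi>] ..
  then show "expect \<beta> \<theta> (\<lambda>\<omega>. rate \<beta> (s * \<omega> i) * \<phi> \<omega>)
      = exp (of_int s * \<theta> i) * expect \<beta> (\<theta>(i := \<theta> i + of_int s * \<beta>)) \<phi>"
    unfolding expect_def eq by simp
qed

text \<open>Changing the profile at \<open>i\<close> amounts to translating coordinate
  \<open>i\<close>, on which \<open>\<phi>\<close> does not depend. This confines all later sums to
  \<open>I\<close>.\<close>

lemma expect_upd_outside:
  assumes "\<beta> > 0" "finite I" "determined_by I \<phi>" "i \<notin> I"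
  shows "expect \<beta> (\<theta>(i := \<theta> i + of_int k * \<beta>)) \<phi> = expect \<beta> \<theta> \<phi>"
proof -
  have "cylinder \<phi>" using assms by (auto simp: cylinder_iff)
  moreover have "\<phi> (fun_upd \<omega> i (\<omega> i + k)) = \<phi> \<omega>" for \<omega>
    using assms(4) by (intro determined_byD[OF assms(3)]) auto
  ultimately show ?thesis using expect_shift[OF assms(1), of \<phi> \<theta> i k] by simp
qed

section \<open>The generator as a finite sum, and summation by parts\<close>

text \<open>A brick at \<open>i\<close> changes the sites \<open>i\<close> and \<open>i + 1\<close>
  only, so a summand can be nonzero only if \<open>i\<close> or \<open>i + 1\<close> lies in
  \<open>I\<close>.\<close>

lemma generator_eq_sum:
  assumes "finite I" "determined_by I \<phi>"
  shows "generator \<beta> \<phi> \<eta> = (\<Sum>i \<in> I \<union> (\<lambda>i. i - 1) ` I.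
    (rate \<beta> (\<eta> i) + rate \<beta> (- \<eta> (i + 1))) * (\<phi> (lay_brick \<eta> i) - \<phi> \<eta>))"
proof -
  have "\<phi> (lay_brick \<eta> i) = \<phi> \<eta>" if "i \<notin> I \<union> (\<lambda>i. i - 1) ` I" for i
  proof (rule determined_byD[OF assms(2)])
    fix j assume "j \<in> I"
    then have "j \<noteq> i \<and> j \<noteq> i + 1" using that by force
    then show "lay_brick \<eta> i j = \<eta> j" by (simp add: lay_brick_def)
  qed
  then show ?thesis
    unfolding generator_def using assms(1)
    by (subst infsum_cong_neutral[where T = "I \<union> (\<lambda>i. i - 1) ` I"]) auto
qed

text \<open>The cancellation behind the theorem: tilting by the rate at \<open>i\<close> raises
  \<open>\<theta> i\<close> by \<open>\<beta>\<close>, and the brick lowers it back while raising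
  \<open>\<theta> (i + 1)\<close>. Likewise the rate at \<open>i + 1\<close> lowers
  \<open>\<theta> (i + 1)\<close>, and the brick restores it while lowering
  \<open>\<theta> i\<close>. Hence every resulting profile differs from \<open>\<theta>\<close> at
  one site only.\<close>

lemma expect_brick_jump:
  assumes "\<beta> > 0" "cylinder \<phi>" "bounded (range \<phi>)"
  defines "f \<equiv> \<lambda>i \<omega>. (rate \<beta> (\<omega> i) + rate \<beta> (- \<omega> (i + 1))) * (\<phi> (lay_brick \<omega> i) - \<phi> \<omega>)"
  shows "integrable (product_measure \<beta> \<theta>) (f i)"
    and "expect \<beta> \<theta> (f i)
      = exp (\<theta> i) * (expect \<beta> (\<theta>(i + 1 := \<theta> (i + 1) + \<beta>)) \<phi> - expect \<beta> (\<theta>(i := \<theta> i + \<beta>)) \<phi>)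
      + exp (- \<theta> (i + 1)) * (expect \<beta> (\<theta>(i := \<theta> i - \<beta>)) \<phi> - expect \<beta> (\<theta>(i + 1 := \<theta> (i + 1) - \<beta>)) \<phi>)"
proof -
  let ?\<psi> = "\<lambda>\<omega>. \<phi> (lay_brick \<omega> i) - \<phi> \<omega>"
  have lay: "cylinder (\<lambda>\<omega>. \<phi> (lay_brick \<omega> i))" by (rule cylinder_lay_brick[OF assms(2)])
  have blay: "bounded (range (\<lambda>\<omega>. \<phi> (lay_brick \<omega> i)))"
    by (rule bounded_subset[OF assms(3)]) auto
  have \<psi>: "cylinder ?\<psi>" by (rule cylinder_diff[OF lay assms(2)])
  have b\<psi>: "bounded (range ?\<psi>)" by (rule bounded_minus_comp[OF blay assms(3)])
  have E\<psi>: "expect \<beta> \<theta>' ?\<psi> = expect \<beta> (\<theta>'(i := \<theta>' i - \<beta>, i + 1 := \<theta>' (i + 1) + \<beta>)) \<phi> - expect \<beta> \<theta>' \<phi>" for \<theta>'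
    using integrable_bounded_cylinder[OF lay blay, of \<beta> \<theta>'] integrable_bounded_cylinder[OF assms(2,3), of \<beta> \<theta>']
    by (subst expect_lay_brick[OF assms(1,2), symmetric]) (simp add: expect_def)
  \<comment> \<open>The factors \<open>1\<close> and \<open>- 1\<close> are kept explicit to match
    the sign \<open>s\<close> in \<open>expect_rate\<close>.\<close>
  have f: "f i = (\<lambda>\<omega>. rate \<beta> (1 * \<omega> i) * ?\<psi> \<omega> + rate \<beta> (- 1 * \<omega> (i + 1)) * ?\<psi> \<omega>)"
    by (simp add: f_def fun_eq_iff algebra_simps)
  note 1 = expect_rate[OF assms(1) \<psi> b\<psi>, where s = 1 and i = i and \<theta> = \<theta>, simplified abs_one]
  note 2 = expect_rate[OF assms(1) \<psi> b\<psi>, where s = "- 1" and i = "i + 1" and \<theta> = \<theta>, simplified abs_minus abs_one]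
  show "integrable (product_measure \<beta> \<theta>) (f i)"
    unfolding f by (intro Bochner_Integration.integrable_add 1(1) 2(1) refl)
  have "expect \<beta> \<theta> (f i) = expect \<beta> \<theta> (\<lambda>\<omega>. rate \<beta> (1 * \<omega> i) * ?\<psi> \<omega>) + expect \<beta> \<theta> (\<lambda>\<omega>. rate \<beta> (- 1 * \<omega> (i + 1)) * ?\<psi> \<omega>)"
    unfolding f expect_def by (intro Bochner_Integration.integral_add 1(1) 2(1) refl)
  also have "\<dots> = exp (\<theta> i) * expect \<beta> (\<theta>(i := \<theta> i + \<beta>)) ?\<psi> + exp (- \<theta> (i + 1)) * expect \<beta> (\<theta>(i + 1 := \<theta> (i + 1) - \<beta>)) ?\<psi>"
    using 1(2) 2(2) by simp
  \<comment> \<open>In the second term the brick returns site \<open>i + 1\<close> to its original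
    value, so that update disappears.\<close>
  moreover have upd: "\<theta>(i := c, i + 1 := \<theta> (i + 1)) = \<theta>(i := c)" for c
    by auto
  ultimately show "expect \<beta> \<theta> (f i)
      = exp (\<theta> i) * (expect \<beta> (\<theta>(i + 1 := \<theta> (i + 1) + \<beta>)) \<phi> - expect \<beta> (\<theta>(i := \<theta> i + \<beta>)) \<phi>)
      + exp (- \<theta> (i + 1)) * (expect \<beta> (\<theta>(i := \<theta> i - \<beta>)) \<phi> - expect \<beta> (\<theta>(i + 1 := \<theta> (i + 1) - \<beta>)) \<phi>)"
    by (simp add: E\<psi> fun_upd_twist upd)
qed

text \<open>Abel summation of the one-brick formulas. Collecting the two occurrences of each
  one-site change leaves the difference of exponentials across a neighbouring bond as its
  coefficient.\<close>

lemma expect_generator: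
  assumes "\<beta> > 0" "finite I" "determined_by I \<phi>" "bounded (range \<phi>)"
  shows "integrable (product_measure \<beta> \<theta>) (generator \<beta> \<phi>)"
    and "expect \<beta> \<theta> (generator \<beta> \<phi>)
      = (\<Sum>i\<in>I. (exp (\<theta> (i - 1)) - exp (\<theta> i)) * (expect \<beta> (\<theta>(i := \<theta> i + \<beta>)) \<phi> - expect \<beta> \<theta> \<phi>))
      + (\<Sum>i\<in>I. (exp (- \<theta> (i + 1)) - exp (- \<theta> i)) * (expect \<beta> (\<theta>(i := \<theta> i - \<beta>)) \<phi> - expect \<beta> \<theta> \<phi>))"
proof -
  have cyl: "cylinder \<phi>" using assms by (auto simp: cylinder_iff)
  let ?J = "I \<union> (\<lambda>i. i - 1) ` I"
  note gen = generator_eq_sum[OF assms(2,3), abs_def, of \<beta>]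
  note jump = expect_brick_jump[OF assms(1) cyl assms(4), of \<theta>]
  show "integrable (product_measure \<beta> \<theta>) (generator \<beta> \<phi>)"
    unfolding gen by (intro Bochner_Integration.integrable_sum jump(1))
  \<comment> \<open>Subtracting the expectation under \<open>\<theta>\<close> cancels in
    \<open>R (i + 1) - R i\<close> and in \<open>L i - L (i + 1)\<close>, and makes \<open>R\<close>
    and \<open>L\<close> vanish off \<open>I\<close>, so that no boundary terms arise.\<close>
  define R where "R i = expect \<beta> (\<theta>(i := \<theta> i + \<beta>)) \<phi> - expect \<beta> \<theta> \<phi>" for i
  define L where "L i = expect \<beta> (\<theta>(i := \<theta> i - \<beta>)) \<phi> - expect \<beta> \<theta> \<phi>" for i
  have R0: "R i = 0" if "i \<notin> I" for i
    using expect_upd_outside[OF assms(1-3) that, of \<theta> 1] by (simp add: R_def)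
  have L0: "L i = 0" if "i \<notin> I" for i
    using expect_upd_outside[OF assms(1-3) that, of \<theta> "- 1"] by (simp add: L_def)
  have here: "(\<Sum>i\<in>?J. g i) = (\<Sum>i\<in>I. g i)" if "\<And>i. i \<notin> I \<Longrightarrow> g i = 0" for g :: "int \<Rightarrow> real"
    using assms(2) that by (intro sum.mono_neutral_right) auto
  \<comment> \<open>The index set contains \<open>I\<close> translated by \<open>- 1\<close>, so
    \<open>i + 1\<close> runs through all of \<open>I\<close>.\<close>
  have shifted: "(\<Sum>i\<in>?J. g (i + 1)) = (\<Sum>i\<in>I. g i)" if "\<And>i. i \<notin> I \<Longrightarrow> g i = 0" for g :: "int \<Rightarrow> real"
  proof -
    have "(\<Sum>i\<in>?J. g (i + 1)) = (\<Sum>i\<in>(\<lambda>i. i - 1) ` I. g (i + 1))"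
    proof (intro sum.mono_neutral_right ballI)
      fix i assume "i \<in> ?J - (\<lambda>i. i - 1) ` I"
      then have "i + 1 \<notin> I" by (auto simp: image_iff dest: bspec[where x = "i + 1"])
      then show "g (i + 1) = 0" by (rule that)
    qed (use assms(2) in auto)
    then show ?thesis by (simp add: sum.reindex inj_on_def)
  qed
  have "expect \<beta> \<theta> (generator \<beta> \<phi>) = (\<Sum>i\<in>?J. expect \<beta> \<theta> (\<lambda>\<omega>. (rate \<beta> (\<omega> i) + rate \<beta> (- \<omega> (i + 1))) * (\<phi> (lay_brick \<omega> i) - \<phi> \<omega>)))"
    unfolding gen expect_def by (intro Bochner_Integration.integral_sum jump(1))
  also have "\<dots> = (\<Sum>i\<in>?J. exp (\<theta> i) * (R (i + 1) - R i) + exp (- \<theta> (i + 1)) * (L i - L (i + 1)))"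
    by (simp add: jump(2) R_def L_def)
  \<comment> \<open>Writing \<open>i + 1 - 1\<close> displays the summand as a function of
    \<open>i + 1\<close>, ready for \<open>shifted\<close>.\<close>
  also have "\<dots> = (\<Sum>i\<in>?J. exp (\<theta> (i + 1 - 1)) * R (i + 1)) - (\<Sum>i\<in>?J. exp (\<theta> i) * R i)
      + ((\<Sum>i\<in>?J. exp (- \<theta> (i + 1)) * L i) - (\<Sum>i\<in>?J. exp (- \<theta> (i + 1)) * L (i + 1)))"
    by (simp add: sum.distrib sum_subtractf right_diff_distrib)
  also have "\<dots> = (\<Sum>i\<in>I. exp (\<theta> (i - 1)) * R i) - (\<Sum>i\<in>I. exp (\<theta> i) * R i)
      + ((\<Sum>i\<in>I. exp (- \<theta> (i + 1)) * L i) - (\<Sum>i\<in>I. exp (- \<theta> i) * L i))"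
    using shifted[of "\<lambda>i. exp (\<theta> (i - 1)) * R i"] shifted[of "\<lambda>i. exp (- \<theta> i) * L i"]
      here[of "\<lambda>i. exp (\<theta> i) * R i"] here[of "\<lambda>i. exp (- \<theta> (i + 1)) * L i"] R0 L0
    by simp
  finally show "expect \<beta> \<theta> (generator \<beta> \<phi>)
      = (\<Sum>i\<in>I. (exp (\<theta> (i - 1)) - exp (\<theta> i)) * (expect \<beta> (\<theta>(i := \<theta> i + \<beta>)) \<phi> - expect \<beta> \<theta> \<phi>))
      + (\<Sum>i\<in>I. (exp (- \<theta> (i + 1)) - exp (- \<theta> i)) * (expect \<beta> (\<theta>(i := \<theta> i - \<beta>)) \<phi> - expect \<beta> \<theta> \<phi>))"
    by (simp add: R_def L_def sum_subtractf left_diff_distrib)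
qed

section \<open>Walkers\<close>

text \<open>Indexes a half-integer by the site to its right, in accordance with a shock between
  \<open>Q - 1\<close> and \<open>Q\<close> being located at \<open>Q - 1/2\<close>.\<close>

lemma half_ints_iff: "x \<in> half_ints \<longleftrightarrow> (\<exists>i. x = of_int i - 1 / 2)"
proof
  assume "x \<in> half_ints"
  then obtain j :: int where "x = of_int j + 1 / 2" by (auto simp: half_ints_def)
  then have "x = of_int (j + 1) - 1 / 2" by simp
  then show "\<exists>i. x = of_int i - 1 / 2" by blast
next
  assume "\<exists>i. x = of_int i - 1 / 2"
  then obtain i :: int where "x = of_int i - 1 / 2" by blast
  then have "x = of_int (i - 1) + 1 / 2" by simp
  then show "x \<in> half_ints" unfolding half_ints_def by blast
qed

lemma half_ints_add_int: "x \<in> half_ints \<Longrightarrow> x + of_int k \<in> half_ints"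
proof -
  assume "x \<in> half_ints"
  then obtain i :: int where "x = of_int i - 1 / 2" by (auto simp: half_ints_iff)
  then have "x + of_int k = of_int (i + k) - 1 / 2" by simp
  then show ?thesis unfolding half_ints_iff by blast
qed

lemma half_int_less_int_iff: "real_of_int i - 1 / 2 < of_int j \<longleftrightarrow> i \<le> j"
  by linarith

text \<open>In the discrete topology of the natural numbers, a summable family has finite
  support.\<close>

lemma finite_walker_sites:
  fixes \<xi> :: "real \<Rightarrow> nat"
  assumes "(\<xi> has_sum n) half_ints" shows "finite {x \<in> half_ints. \<xi> x > 0}"
  using assms summable_on_discrete_iff[of \<xi> half_ints] by (auto simp: summable_on_def)

text \<open>\<open>F\<close> may exceed the set of occupied sites, so that two configurations can be
  counted over one common finite set.\<close>

lemma walkers_left_eq_sum: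
  assumes "finite F" "F \<subseteq> half_ints" "{x \<in> half_ints. \<xi> x > 0} \<subseteq> F"
  shows "walkers_left \<xi> a = (\<Sum>y\<in>{y \<in> F. y < a}. \<xi> y)"
  unfolding walkers_left_def
  using assms by (subst infsum_cong_neutral[where T = "{y \<in> F. y < a}"]) auto

text \<open>The only half-integer between \<open>i - 1\<close> and \<open>i\<close> is
  \<open>i - 1/2\<close>.\<close>

lemma walkers_left_step:
  assumes "finite {x \<in> half_ints. \<xi> x > 0}"
  shows "walkers_left \<xi> (of_int i - 1 / 2) = walkers_left \<xi> (of_int (i - 1))"
    and "walkers_left \<xi> (of_int i) = walkers_left \<xi> (of_int (i - 1)) + \<xi> (of_int i - 1 / 2)"
proof -
  let ?x = "real_of_int i - 1 / 2"
  \<comment> \<open>Including the point even when it is empty avoids a case distinction on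
    \<open>\<xi>\<close>.\<close>
  let ?F = "insert ?x {x \<in> half_ints. \<xi> x > 0}"
  have x: "?x \<in> half_ints" unfolding half_ints_iff by blast
  have sum: "walkers_left \<xi> a = (\<Sum>y\<in>{y \<in> ?F. y < a}. \<xi> y)" for a
    using assms x by (intro walkers_left_eq_sum) auto
  have "y < ?x \<longleftrightarrow> y < of_int (i - 1)" "y < of_int i \<longleftrightarrow> y = ?x \<or> y < of_int (i - 1)" if y: "y \<in> half_ints" for y
  proof -
    obtain j :: int where y: "y = of_int j - 1 / 2" using y by (auto simp: half_ints_iff)
    show "y < ?x \<longleftrightarrow> y < of_int (i - 1)" "y < of_int i \<longleftrightarrow> y = ?x \<or> y < of_int (i - 1)"
      unfolding y half_int_less_int_iff by auto
  qed
  then have "{y \<in> ?F. y < ?x} = {y \<in> ?F. y < of_int (i - 1)}"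
    and *: "{y \<in> ?F. y < of_int i} = insert ?x {y \<in> ?F. y < of_int (i - 1)}"
    using x by blast+
  then show "walkers_left \<xi> ?x = walkers_left \<xi> (of_int (i - 1))"
    by (simp only: sum)
  have "finite {y \<in> ?F. y < of_int (i - 1)}" using assms by simp
  moreover have "?x \<notin> {y \<in> ?F. y < of_int (i - 1)}" by simp
  ultimately show "walkers_left \<xi> (of_int i) = walkers_left \<xi> (of_int (i - 1)) + \<xi> ?x"
    unfolding sum * by (subst sum.insert) auto
qed

text \<open>The additive form avoids truncated subtraction of natural numbers. Before and after the
  move, the configurations differ by the indicators of \<open>x\<close> and
  \<open>y\<close>.\<close>

lemma walkers_left_move:
  assumes "finite {x \<in> half_ints. \<xi> x > 0}" "x \<in> half_ints" "y \<in> half_ints" "x \<noteq> y" "\<xi> x > 0"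
  shows "walkers_left (move_walker \<xi> x y) a + (if x < a then 1 else 0)
    = walkers_left \<xi> a + (if y < a then 1 else 0)"
proof -
  let ?F = "{x, y} \<union> {x \<in> half_ints. \<xi> x > 0}"
  let ?A = "{z \<in> ?F. z < a}"
  have fin: "finite ?A" using assms(1) by simp
  have F: "finite ?F" "?F \<subseteq> half_ints" using assms by auto
  have "{z \<in> half_ints. move_walker \<xi> x y z > 0} \<subseteq> ?F" "{z \<in> half_ints. \<xi> z > 0} \<subseteq> ?F"
    by (auto simp: move_walker_def)
  note sum = this[THEN walkers_left_eq_sum[OF F]]
  have one: "(\<Sum>z\<in>?A. if z = w then 1 else 0) = (if w < a then 1 else 0 :: nat)" if "w \<in> ?F" for w
    using fin that by (subst sum.delta) auto
  \<comment> \<open>Positivity of \<open>\<xi> x\<close> makes the subtraction in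
    \<open>move_walker\<close> genuine, and \<open>x \<noteq> y\<close> keeps its two updates
    apart.\<close>
  have "(\<Sum>z\<in>?A. move_walker \<xi> x y z + (if z = x then 1 else 0)) = (\<Sum>z\<in>?A. \<xi> z + (if z = y then 1 else 0))"
    using assms(4,5) by (intro sum.cong) (auto simp: move_walker_def)
  then show ?thesis
    using one[of x] one[of y] by (simp add: sum sum.distrib)
qed

section \<open>The profile and the motion of walkers\<close>

lemma profile_step:
  assumes "finite {x \<in> half_ints. \<xi> x > 0}"
  shows "profile \<beta> \<theta>left \<xi> i = profile \<beta> \<theta>left \<xi> (i - 1) - real (\<xi> (of_int i - 1 / 2)) * \<beta>"
  unfolding profile_def walkers_left_step(2)[OF assms, of i] by (simp add: algebra_simps)

text \<open>On its way from \<open>i - 1/2\<close> to \<open>i + 1/2\<close> the walker crosses site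
  \<open>i\<close> alone, so only the count to the left of \<open>i\<close> drops by one.\<close>

lemma profile_move_right:
  assumes "finite {x \<in> half_ints. \<xi> x > 0}" "\<xi> (of_int i - 1 / 2) > 0"
  shows "profile \<beta> \<theta>left (move_walker \<xi> (of_int i - 1 / 2) (of_int i - 1 / 2 + 1))
    = (profile \<beta> \<theta>left \<xi>)(i := profile \<beta> \<theta>left \<xi> i + \<beta>)"
proof
  fix j
  let ?x = "real_of_int i - 1 / 2"
  have x: "?x \<in> half_ints" unfolding half_ints_iff by blast
  have "walkers_left (move_walker \<xi> ?x (?x + 1)) (of_int j) + (if ?x < of_int j then 1 else 0)
      = walkers_left \<xi> (of_int j) + (if ?x + 1 < of_int j then 1 else 0)"
    using half_ints_add_int[OF x, of 1] assms x by (intro walkers_left_move) auto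
  moreover have "?x < of_int j \<longleftrightarrow> i \<le> j" "?x + 1 < of_int j \<longleftrightarrow> i + 1 \<le> j" by linarith+
  ultimately have "real (walkers_left (move_walker \<xi> ?x (?x + 1)) (of_int j)) + (if i = j then 1 else 0)
      = real (walkers_left \<xi> (of_int j))"
    by (smt (verit) of_nat_1 of_nat_add of_nat_0)
  then show "profile \<beta> \<theta>left (move_walker \<xi> ?x (?x + 1)) j
      = ((profile \<beta> \<theta>left \<xi>)(i := profile \<beta> \<theta>left \<xi> i + \<beta>)) j"
    by (auto simp: profile_def algebra_simps split: if_splits)
      (metis add.commute distrib_left mult.right_neutral)
qed

text \<open>Here the walker starts to the right of site \<open>i\<close>, at \<open>i + 1/2\<close>,
  and crossing \<open>i\<close> increases the count to its left by one.\<close>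

lemma profile_move_left:
  assumes "finite {x \<in> half_ints. \<xi> x > 0}" "\<xi> (of_int i + 1 / 2) > 0"
  shows "profile \<beta> \<theta>left (move_walker \<xi> (of_int i + 1 / 2) (of_int i + 1 / 2 - 1))
    = (profile \<beta> \<theta>left \<xi>)(i := profile \<beta> \<theta>left \<xi> i - \<beta>)"
proof
  fix j
  let ?x = "real_of_int i + 1 / 2"
  have x: "?x \<in> half_ints" unfolding half_ints_def by blast
  have "walkers_left (move_walker \<xi> ?x (?x - 1)) (of_int j) + (if ?x < of_int j then 1 else 0)
      = walkers_left \<xi> (of_int j) + (if ?x - 1 < of_int j then 1 else 0)"
    using half_ints_add_int[OF x, of "- 1"] assms x by (intro walkers_left_move) auto
  moreover have "?x < of_int j \<longleftrightarrow> i + 1 \<le> j" "?x - 1 < of_int j \<longleftrightarrow> i \<le> j" by linarith+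
  ultimately have "real (walkers_left (move_walker \<xi> ?x (?x - 1)) (of_int j))
      = real (walkers_left \<xi> (of_int j)) + (if i = j then 1 else 0)"
    by (smt (verit) of_nat_1 of_nat_add of_nat_0)
  then show "profile \<beta> \<theta>left (move_walker \<xi> ?x (?x - 1)) j
      = ((profile \<beta> \<theta>left \<xi>)(i := profile \<beta> \<theta>left \<xi> i - \<beta>)) j"
    by (auto simp: profile_def algebra_simps)
qed

text \<open>Change of index between occupied half-integers and lattice sites: both sums reduce to
  the sites of \<open>I\<close> whose half-integer is occupied. The offset \<open>c\<close> tells on
  which side of \<open>i\<close> the walker sits, \<open>0\<close> for the left and \<open>1\<close>
  for the right.\<close>

lemma sum_walker_sites:
  fixes \<xi> :: "real \<Rightarrow> nat" and g :: "real \<Rightarrow> real" and f :: "int \<Rightarrow> real" and c :: int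
  assumes "finite {x \<in> half_ints. \<xi> x > 0}" "finite I"
    and g: "\<And>i. \<xi> (of_int (i + c) - 1 / 2) > 0 \<Longrightarrow> g (of_int (i + c) - 1 / 2) = f i"
    and f: "\<And>i. \<xi> (of_int (i + c) - 1 / 2) = 0 \<Longrightarrow> f i = 0" "\<And>i. i \<notin> I \<Longrightarrow> f i = 0"
  shows "(\<Sum>x\<in>{x \<in> half_ints. \<xi> x > 0}. g x) = (\<Sum>i\<in>I. f i)"
proof -
  let ?h = "\<lambda>i. real_of_int (i + c) - 1 / 2"
  let ?K = "{i. \<xi> (?h i) > 0}"
  have inj: "inj_on ?h A" for A by (auto simp: inj_on_def)
  have S: "{x \<in> half_ints. \<xi> x > 0} = ?h ` ?K"
  proof (intro equalityI subsetI)
    fix x assume "x \<in> {x \<in> half_ints. \<xi> x > 0}"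
    then obtain i :: int where i: "x = of_int i - 1 / 2" "\<xi> x > 0" by (auto simp: half_ints_iff)
    then show "x \<in> ?h ` ?K" by (intro image_eqI[where x = "i - c"]) auto
  next
    fix x assume "x \<in> ?h ` ?K"
    then show "x \<in> {x \<in> half_ints. \<xi> x > 0}" unfolding half_ints_iff by blast
  qed
  have K: "finite ?K" using assms(1) unfolding S by (rule finite_imageD[OF _ inj])
  have "(\<Sum>x\<in>{x \<in> half_ints. \<xi> x > 0}. g x) = (\<Sum>i\<in>?K. f i)"
    unfolding S sum.reindex[OF inj] using g by (intro sum.cong) auto
  also have "\<dots> = (\<Sum>i\<in>?K \<inter> I. f i)"
    using K f(2) by (intro sum.mono_neutral_right) auto
  also have "\<dots> = (\<Sum>i\<in>I. f i)"
  proof (intro sum.mono_neutral_left ballI)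
    fix i assume "i \<in> I - ?K \<inter> I"
    then have "\<xi> (?h i) = 0" by auto
    then show "f i = 0" by (rule f(1))
  qed (use assms(2) in auto)
  finally show ?thesis .
qed

text \<open>The coefficients from the summation by parts are the jump rates: with \<open>k\<close>
  walkers to the left of \<open>i - 1/2\<close> and \<open>m\<close> walkers there, the profile is
  \<open>\<theta>left - k \<beta>\<close> at \<open>i - 1\<close> and lower by
  \<open>m \<beta>\<close> at \<open>i\<close>. Changing the profile at \<open>i\<close> moves one
  walker across \<open>i\<close>.\<close>

lemma expect_generator_profile:
  assumes "\<beta> > 0" "finite {x \<in> half_ints. \<xi> x > 0}" "cylinder \<phi>" "bounded (range \<phi>)"
  shows "expect \<beta> (profile \<beta> \<theta>left \<xi>) (generator \<beta> \<phi>)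
    = walkers_generator \<beta> \<theta>left (\<lambda>\<eta>. expect \<beta> (profile \<beta> \<theta>left \<eta>) \<phi>) \<xi>"
proof -
  obtain I where I: "finite I" "determined_by I \<phi>" using assms(3) by (auto simp: cylinder_iff)
  let ?\<theta> = "profile \<beta> \<theta>left \<xi>"
  let ?S = "{x \<in> half_ints. \<xi> x > 0}"
  define E where "E \<theta> = expect \<beta> \<theta> \<phi>" for \<theta>
  note step = profile_step[OF assms(2), of \<beta> \<theta>left]
  have up: "E (?\<theta>(i := ?\<theta> i + \<beta>)) = E ?\<theta>" if "i \<notin> I" for i
    using expect_upd_outside[OF assms(1) I that, of ?\<theta> 1] by (simp add: E_def)
  have down: "E (?\<theta>(i := ?\<theta> i - \<beta>)) = E ?\<theta>" if "i \<notin> I" for i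
    using expect_upd_outside[OF assms(1) I that, of ?\<theta> "- 1"] by (simp add: E_def)
  have right: "right_rate \<beta> \<theta>left (\<xi> (of_int i - 1 / 2)) (walkers_left \<xi> (of_int i - 1 / 2))
      = exp (?\<theta> (i - 1)) - exp (?\<theta> i)" for i
    unfolding step[of i]
    by (simp add: right_rate_def profile_def walkers_left_step(1)[OF assms(2), simplified] algebra_simps flip: exp_add)
  have left: "left_rate \<beta> \<theta>left (\<xi> (of_int i - 1 / 2)) (walkers_left \<xi> (of_int i - 1 / 2))
      = exp (- ?\<theta> i) - exp (- ?\<theta> (i - 1))" for i
    unfolding step[of i]
    by (simp add: left_rate_def profile_def walkers_left_step(1)[OF assms(2), simplified] algebra_simps flip: exp_add)
  have flat: "exp (?\<theta> (i - 1)) - exp (?\<theta> i) = 0" if "\<xi> (of_int i - 1 / 2) = 0" for i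
    using step[of i] that by simp
  \<comment> \<open>A right jump across \<open>i\<close> starts at \<open>i - 1/2\<close>, hence the
    offset \<open>0\<close>.\<close>
  have R: "(\<Sum>x\<in>?S. right_rate \<beta> \<theta>left (\<xi> x) (walkers_left \<xi> x) * (E (profile \<beta> \<theta>left (move_walker \<xi> x (x + 1))) - E ?\<theta>))
      = (\<Sum>i\<in>I. (exp (?\<theta> (i - 1)) - exp (?\<theta> i)) * (E (?\<theta>(i := ?\<theta> i + \<beta>)) - E ?\<theta>))"
  proof (rule sum_walker_sites[where c = 0, OF assms(2) I(1)])
    fix i
    assume "\<xi> (of_int (i + 0) - 1 / 2) > 0"
    then have pos: "\<xi> (of_int i - 1 / 2) > 0" by simp
    show "right_rate \<beta> \<theta>left (\<xi> (of_int (i + 0) - 1 / 2)) (walkers_left \<xi> (of_int (i + 0) - 1 / 2))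
        * (E (profile \<beta> \<theta>left (move_walker \<xi> (of_int (i + 0) - 1 / 2) (of_int (i + 0) - 1 / 2 + 1))) - E ?\<theta>)
      = (exp (?\<theta> (i - 1)) - exp (?\<theta> i)) * (E (?\<theta>(i := ?\<theta> i + \<beta>)) - E ?\<theta>)"
      by (simp only: add_0_right right profile_move_right[OF assms(2) pos])
  qed (simp_all add: up flat)
  \<comment> \<open>A left jump across \<open>i\<close> starts at
    \<open>i + 1/2 = (i + 1) - 1/2\<close>, hence the offset \<open>1\<close>.\<close>
  have L: "(\<Sum>x\<in>?S. left_rate \<beta> \<theta>left (\<xi> x) (walkers_left \<xi> x) * (E (profile \<beta> \<theta>left (move_walker \<xi> x (x - 1))) - E ?\<theta>))
      = (\<Sum>i\<in>I. (exp (- ?\<theta> (i + 1)) - exp (- ?\<theta> i)) * (E (?\<theta>(i := ?\<theta> i - \<beta>)) - E ?\<theta>))"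
  proof (rule sum_walker_sites[where c = 1, OF assms(2) I(1)])
    fix i
    assume pos: "\<xi> (of_int (i + 1) - 1 / 2) > 0"
    have x: "real_of_int (i + 1) - 1 / 2 = of_int i + 1 / 2" by simp
    have "profile \<beta> \<theta>left (move_walker \<xi> (of_int (i + 1) - 1 / 2) (of_int (i + 1) - 1 / 2 - 1)) = ?\<theta>(i := ?\<theta> i - \<beta>)"
      using pos profile_move_left[OF assms(2)] unfolding x by blast
    then show "left_rate \<beta> \<theta>left (\<xi> (of_int (i + 1) - 1 / 2)) (walkers_left \<xi> (of_int (i + 1) - 1 / 2))
        * (E (profile \<beta> \<theta>left (move_walker \<xi> (of_int (i + 1) - 1 / 2) (of_int (i + 1) - 1 / 2 - 1))) - E ?\<theta>)
      = (exp (- ?\<theta> (i + 1)) - exp (- ?\<theta> i)) * (E (?\<theta>(i := ?\<theta> i - \<beta>)) - E ?\<theta>)"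
      unfolding left by simp
  next
    fix i assume "\<xi> (of_int (i + 1) - 1 / 2) = 0"
    then show "(exp (- ?\<theta> (i + 1)) - exp (- ?\<theta> i)) * (E (?\<theta>(i := ?\<theta> i - \<beta>)) - E ?\<theta>) = 0"
      using step[of "i + 1"] by simp
  qed (simp add: down)
  show ?thesis
    using expect_generator(2)[OF assms(1) I assms(4), of ?\<theta>] R L
    by (simp add: walkers_generator_def E_def sum.distrib)
qed

section \<open>A single shock of size one\<close>

text \<open>The walker at \<open>x\<close> exhausts the total, so the remaining natural numbers sum
  to zero and all vanish.\<close>

lemma single_walker_sites:
  fixes \<xi> :: "real \<Rightarrow> nat"
  assumes "(\<xi> has_sum 1) half_ints" "x \<in> half_ints" "\<xi> x = 1"
  shows "{y \<in> half_ints. \<xi> y > 0} = {x}"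
proof -
  let ?S = "{y \<in> half_ints. \<xi> y > 0}"
  note fin = finite_walker_sites[OF assms(1)]
  have x: "x \<in> ?S" using assms by simp
  have "(\<xi> has_sum (\<Sum>y\<in>?S. \<xi> y)) half_ints"
    using fin by (intro has_sum_finite_neutralI) auto
  then have "(\<Sum>y\<in>?S. \<xi> y) = 1" using assms(1) infsumI by metis
  then have "(\<Sum>y\<in>?S - {x}. \<xi> y) = 0"
    using sum.remove[OF fin x, of \<xi>] assms(3) by simp
  then have "\<xi> y = 0" if "y \<in> ?S - {x}" for y using fin that by auto
  then show ?thesis using x by auto
qed

lemma walkers_left_single:
  assumes "x \<in> half_ints" "{y \<in> half_ints. \<xi> y > 0} = {x}"
  shows "walkers_left \<xi> a = (if x < a then \<xi> x else 0)"
proof -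
  have "{y \<in> {x}. y < a} = (if x < a then {x} else {})" by auto
  then show ?thesis using walkers_left_eq_sum[of "{x}" \<xi> a] assms by simp
qed

text \<open>A half-integer is never an integer, so the strict comparisons \<open>x < i\<close> and
  \<open>i < x\<close> are complementary. Assuming only the counts makes the lemma apply before and
  after a jump.\<close>

lemma profile_eq_step_profile:
  assumes "x \<in> half_ints" "\<And>a. walkers_left \<xi> a = (if x < a then 1 else 0)"
  shows "profile \<beta> \<theta>left \<xi> = step_profile \<theta>left (\<theta>left - \<beta>) x"
proof
  fix i
  obtain j :: int where "x = of_int j - 1 / 2" using assms(1) by (auto simp: half_ints_iff)
  then have "x < of_int i \<longleftrightarrow> j \<le> i" "of_int i < x \<longleftrightarrow> i < j" by linarith+
  then have "of_int i < x \<longleftrightarrow> \<not> x < of_int i" by auto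
  then show "profile \<beta> \<theta>left \<xi> i = step_profile \<theta>left (\<theta>left - \<beta>) x i"
    by (simp add: profile_def step_profile_def assms(2))
qed

theorem mainTheorem2:
  fixes \<beta> \<theta>left :: real and n :: nat and \<xi> :: "real \<Rightarrow> nat"
  assumes "\<beta> > 0" and "n \<ge> 1" and "(\<xi> has_sum n) half_ints"
  shows
    "(\<forall>Q. shock \<beta> (profile \<beta> \<theta>left \<xi>) Q (\<xi> (of_int Q - 1 / 2))) \<and>
    (\<forall>\<phi>. cylinder \<phi> \<and> bounded (range \<phi>) \<longrightarrow>
      integrable (product_measure \<beta> (profile \<beta> \<theta>left \<xi>)) (generator \<beta> \<phi>) \<and>
      expect \<beta> (profile \<beta> \<theta>left \<xi>) (generator \<beta> \<phi>) =
        (\<Sum>x\<in>{x \<in> half_ints. \<xi> x > 0}.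
            exp (\<theta>left - real (walkers_left \<xi> x) * \<beta>) * (1 - exp (- real (\<xi> x) * \<beta>))
              * (expect \<beta> (profile \<beta> \<theta>left (move_walker \<xi> x (x + 1))) \<phi>
                 - expect \<beta> (profile \<beta> \<theta>left \<xi>) \<phi>)
          + exp (- \<theta>left + real (walkers_left \<xi> x) * \<beta>) * (exp (real (\<xi> x) * \<beta>) - 1)
              * (expect \<beta> (profile \<beta> \<theta>left (move_walker \<xi> x (x - 1))) \<phi>
                 - expect \<beta> (profile \<beta> \<theta>left \<xi>) \<phi>))) \<and>
    (\<forall>\<phi>. cylinder \<phi> \<and> bounded (range \<phi>) \<longrightarrow>
      expect \<beta> (profile \<beta> \<theta>left \<xi>) (generator \<beta> \<phi>) =
        walkers_generator \<beta> \<theta>left (\<lambda>\<eta>. expect \<beta> (profile \<beta> \<theta>left \<eta>) \<phi>) \<xi>) \<and>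
    (\<forall>\<theta>right x. n = 1 \<and> \<theta>right = \<theta>left - \<beta> \<and> x \<in> half_ints \<and> \<xi> x = 1 \<longrightarrow>
      profile \<beta> \<theta>left \<xi> = step_profile \<theta>left \<theta>right x \<and>
      right_rate \<beta> \<theta>left (\<xi> x) (walkers_left \<xi> x) = exp \<theta>left - exp \<theta>right \<and>
      left_rate \<beta> \<theta>left (\<xi> x) (walkers_left \<xi> x) = exp (- \<theta>right) - exp (- \<theta>left) \<and>
      (\<forall>\<phi>. cylinder \<phi> \<and> bounded (range \<phi>) \<longrightarrow>
        expect \<beta> (step_profile \<theta>left \<theta>right x) (generator \<beta> \<phi>) =
            (exp \<theta>left - exp \<theta>right)
              * (expect \<beta> (step_profile \<theta>left \<theta>right (x + 1)) \<phi>
                 - expect \<beta> (step_profile \<theta>left \<theta>right x) \<phi>)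
          + (exp (- \<theta>right) - exp (- \<theta>left))
              * (expect \<beta> (step_profile \<theta>left \<theta>right (x - 1)) \<phi>
                 - expect \<beta> (step_profile \<theta>left \<theta>right x) \<phi>)))"
proof (intro conjI)
  note sites = finite_walker_sites[OF assms(3)]
  show "\<forall>Q. shock \<beta> (profile \<beta> \<theta>left \<xi>) Q (\<xi> (of_int Q - 1 / 2))"
    unfolding shock_def using profile_step[OF sites] by blast
  have gen: "expect \<beta> (profile \<beta> \<theta>left \<xi>) (generator \<beta> \<phi>) =
        walkers_generator \<beta> \<theta>left (\<lambda>\<eta>. expect \<beta> (profile \<beta> \<theta>left \<eta>) \<phi>) \<xi>"
    if "cylinder \<phi> \<and> bounded (range \<phi>)" for \<phi>
    using that expect_generator_profile[OF assms(1) sites] by blast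
  then show "\<forall>\<phi>. cylinder \<phi> \<and> bounded (range \<phi>) \<longrightarrow>
      expect \<beta> (profile \<beta> \<theta>left \<xi>) (generator \<beta> \<phi>) =
        walkers_generator \<beta> \<theta>left (\<lambda>\<eta>. expect \<beta> (profile \<beta> \<theta>left \<eta>) \<phi>) \<xi>"
    by blast
  \<comment> \<open>The integral of a non-integrable function is \<open>0\<close> by convention;
    integrability makes the identity of expectations meaningful.\<close>
  have "integrable (product_measure \<beta> \<theta>) (generator \<beta> \<phi>)"
    if "cylinder \<phi> \<and> bounded (range \<phi>)" for \<phi> \<theta>
    using that expect_generator(1)[OF assms(1)] by (auto simp: cylinder_iff)
  with gen show "\<forall>\<phi>. cylinder \<phi> \<and> bounded (range \<phi>) \<longrightarrow>
      integrable (product_measure \<beta> (profile \<beta> \<theta>left \<xi>)) (generator \<beta> \<phi>) \<and>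
      expect \<beta> (profile \<beta> \<theta>left \<xi>) (generator \<beta> \<phi>) =
        (\<Sum>x\<in>{x \<in> half_ints. \<xi> x > 0}.
            exp (\<theta>left - real (walkers_left \<xi> x) * \<beta>) * (1 - exp (- real (\<xi> x) * \<beta>))
              * (expect \<beta> (profile \<beta> \<theta>left (move_walker \<xi> x (x + 1))) \<phi>
                 - expect \<beta> (profile \<beta> \<theta>left \<xi>) \<phi>)
          + exp (- \<theta>left + real (walkers_left \<xi> x) * \<beta>) * (exp (real (\<xi> x) * \<beta>) - 1)
              * (expect \<beta> (profile \<beta> \<theta>left (move_walker \<xi> x (x - 1))) \<phi>
                 - expect \<beta> (profile \<beta> \<theta>left \<xi>) \<phi>))"
    unfolding walkers_generator_def right_rate_def left_rate_def by blast
  show "\<forall>\<theta>right x. n = 1 \<and> \<theta>right = \<theta>left - \<beta> \<and> x \<in> half_ints \<and> \<xi> x = 1 \<longrightarrow>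
      profile \<beta> \<theta>left \<xi> = step_profile \<theta>left \<theta>right x \<and>
      right_rate \<beta> \<theta>left (\<xi> x) (walkers_left \<xi> x) = exp \<theta>left - exp \<theta>right \<and>
      left_rate \<beta> \<theta>left (\<xi> x) (walkers_left \<xi> x) = exp (- \<theta>right) - exp (- \<theta>left) \<and>
      (\<forall>\<phi>. cylinder \<phi> \<and> bounded (range \<phi>) \<longrightarrow>
        expect \<beta> (step_profile \<theta>left \<theta>right x) (generator \<beta> \<phi>) =
            (exp \<theta>left - exp \<theta>right)
              * (expect \<beta> (step_profile \<theta>left \<theta>right (x + 1)) \<phi>
                 - expect \<beta> (step_profile \<theta>left \<theta>right x) \<phi>)
          + (exp (- \<theta>right) - exp (- \<theta>left))
              * (expect \<beta> (step_profile \<theta>left \<theta>right (x - 1)) \<phi>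
                 - expect \<beta> (step_profile \<theta>left \<theta>right x) \<phi>))"
  proof (intro allI impI)
    fix \<theta>right x
    assume *: "n = 1 \<and> \<theta>right = \<theta>left - \<beta> \<and> x \<in> half_ints \<and> \<xi> x = 1"
    then have x: "x \<in> half_ints" "\<xi> x = 1" and \<theta>right: "\<theta>right = \<theta>left - \<beta>" by auto
    have S: "{y \<in> half_ints. \<xi> y > 0} = {x}"
      using * assms(3) by (intro single_walker_sites) auto
    note left = walkers_left_single[OF x(1) S, unfolded x(2)]
    have profile: "profile \<beta> \<theta>left \<xi> = step_profile \<theta>left \<theta>right x"
      unfolding \<theta>right by (rule profile_eq_step_profile[OF x(1) left])
    \<comment> \<open>The counts after the jump follow from \<open>walkers_left_move\<close> and the
      counts before it, without determining the new occupied sites.\<close>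
    have moved: "profile \<beta> \<theta>left (move_walker \<xi> x y) = step_profile \<theta>left \<theta>right y"
      if "y \<in> half_ints" "x \<noteq> y" for y
      unfolding \<theta>right
    proof (rule profile_eq_step_profile[OF that(1)])
      show "walkers_left (move_walker \<xi> x y) a = (if y < a then 1 else 0)" for a
        using walkers_left_move[OF sites x(1) that, of a] x(2) by (simp add: left)
    qed
    have right_moved: "profile \<beta> \<theta>left (move_walker \<xi> x (x + 1)) = step_profile \<theta>left \<theta>right (x + 1)"
      using half_ints_add_int[OF x(1), of 1] by (intro moved) auto
    have left_moved: "profile \<beta> \<theta>left (move_walker \<xi> x (x - 1)) = step_profile \<theta>left \<theta>right (x - 1)"
      using half_ints_add_int[OF x(1), of "- 1"] by (intro moved) auto
    have right_rate: "right_rate \<beta> \<theta>left (\<xi> x) (walkers_left \<xi> x) = exp \<theta>left - exp \<theta>right"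
      by (simp add: right_rate_def x(2) left \<theta>right algebra_simps flip: exp_add)
    have left_rate: "left_rate \<beta> \<theta>left (\<xi> x) (walkers_left \<xi> x) = exp (- \<theta>right) - exp (- \<theta>left)"
      by (simp add: left_rate_def x(2) left \<theta>right algebra_simps flip: exp_add)
    show "profile \<beta> \<theta>left \<xi> = step_profile \<theta>left \<theta>right x \<and>
      right_rate \<beta> \<theta>left (\<xi> x) (walkers_left \<xi> x) = exp \<theta>left - exp \<theta>right \<and>
      left_rate \<beta> \<theta>left (\<xi> x) (walkers_left \<xi> x) = exp (- \<theta>right) - exp (- \<theta>left) \<and>
      (\<forall>\<phi>. cylinder \<phi> \<and> bounded (range \<phi>) \<longrightarrow>
        expect \<beta> (step_profile \<theta>left \<theta>right x) (generator \<beta> \<phi>) =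
            (exp \<theta>left - exp \<theta>right)
              * (expect \<beta> (step_profile \<theta>left \<theta>right (x + 1)) \<phi>
                 - expect \<beta> (step_profile \<theta>left \<theta>right x) \<phi>)
          + (exp (- \<theta>right) - exp (- \<theta>left))
              * (expect \<beta> (step_profile \<theta>left \<theta>right (x - 1)) \<phi>
                 - expect \<beta> (step_profile \<theta>left \<theta>right x) \<phi>))"
      \<comment> \<open>By \<open>S\<close> the sum over occupied sites consists of the term at
        \<open>x\<close> alone.\<close>
      using profile right_rate left_rate gen
      by (simp add: walkers_generator_def S right_moved left_moved)
  qed
qed

end
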